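(* Let $X$ be a finite discrete space with at least two elements and $\Gamma$ a nonempty countable set. For $\eta:\Gamma\to\Gamma$ let $\sigma_\eta:X^\Gamma\to X^\Gamma$ be the generalized shift $\sigma_\eta((x_\alpha)_{\alpha\in\Gamma})=(x_{\eta(\alpha)})_{\alpha\in\Gamma}$. Let $\mathcal{C}_{Devaney}$, $\mathcal{C}_{Densely}$ and $\mathcal{C}_{LY}$ be the classes of all systems $(X^\Gamma,\sigma_\eta)$, $\eta\in\Gamma^\Gamma$, which are respectively Devaney chaotic, densely chaotic and Li--Yorke chaotic. Then $$\mathcal{C}_{Devaney}\subseteq\mathcal{C}_{Densely}\subseteq\mathcal{C}_{LY}.$$ Moreover, if $\Gamma$ is infinite (and countable), both inclusions are proper.
   Context: $X^\Gamma$ carries the product topology. Write $\Gamma=\{\beta_1,\beta_2,\ldots\}$ for a fixed enumeration of $\Gamma$ (a finite list if $\Gamma$ is finite) and equip $X^\Gamma$ with the compatible metric $D((x_\alpha)_{\alpha\in\Gamma},(y_\alpha)_{\alpha\in\Gamma})=\sum_{n\ge1}\delta(x_{\beta_n},y_{\beta_n})/2^n$ (sum over the indices of the enumeration), where $\delta(a,b)=0$ if $a=b$ and $\delta(a,b)=1$ if $a\ne b$. Let $f:Z\to Z$ be a continuous self-map of a compact metric space $(Z,d)$. A pair $(x,y)\in Z\times Z$ is a scrambled pair if $\liminf_{n\to\infty}d(f^n(x),f^n(y))=0$ and $\limsup_{n\to\infty}d(f^n(x),f^n(y))>0$; $S(Z,f)$ is the set of all scrambled pairs. A scrambled set is a subset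 of $Z$ with at least two elements, every two distinct elements of which form a scrambled pair. The system $(Z,f)$ is: - Li--Yorke chaotic if $Z$ has an uncountable scrambled subset; - densely chaotic if $S(Z,f)$ is dense in $Z\times Z$; - topologically transitive if for all nonempty open subsets $U,V$ of $Z$ there exists $n\ge1$ with $U\cap f^n(V)\ne\varnothing$; - sensitive (dependent on initial conditions) if there exists $\varepsilon>0$ such that for all $x\in Z$ and every open neighbourhood $V$ of $x$ there exist $n\ge0$ and $y\in V$ with $d(f^n(x),f^n(y))>\varepsilon$; - Devaney chaotic if it is topologically transitive, the set of periodic points of $f$ (points $z$ with $f^n(z)=z$ for some $n\ge1$) is dense in $Z$, and it is sensitive. *)

theory Defs
  imports "HOL-Analysis.Analysis"
begin

section \<open>Chaos notions for a self-map of a metric space with carrier Z and distance d\<close>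

text \<open>The limits are taken in the extended reals, where they always exist.\<close>

definition scrambled_pair :: "('z \<Rightarrow> 'z \<Rightarrow> real) \<Rightarrow> ('z \<Rightarrow> 'z) \<Rightarrow> 'z \<Rightarrow> 'z \<Rightarrow> bool" where
  "scrambled_pair d f x y \<longleftrightarrow>
     liminf (\<lambda>n. ereal (d ((f ^^ n) x) ((f ^^ n) y))) = 0 \<and>
     limsup (\<lambda>n. ereal (d ((f ^^ n) x) ((f ^^ n) y))) > 0"

definition scrambled_pairs ::
  "'z set \<Rightarrow> ('z \<Rightarrow> 'z \<Rightarrow> real) \<Rightarrow> ('z \<Rightarrow> 'z) \<Rightarrow> ('z \<times> 'z) set" where
  "scrambled_pairs Z d f = {(x, y). x \<in> Z \<and> y \<in> Z \<and> scrambled_pair d f x y}"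

definition scrambled_set ::
  "'z set \<Rightarrow> ('z \<Rightarrow> 'z \<Rightarrow> real) \<Rightarrow> ('z \<Rightarrow> 'z) \<Rightarrow> 'z set \<Rightarrow> bool" where
  "scrambled_set Z d f S \<longleftrightarrow>
     S \<subseteq> Z \<and> (\<exists>x\<in>S. \<exists>y\<in>S. x \<noteq> y) \<and>
     (\<forall>x\<in>S. \<forall>y\<in>S. x \<noteq> y \<longrightarrow> scrambled_pair d f x y)"

definition Li_Yorke_chaotic ::
  "'z set \<Rightarrow> ('z \<Rightarrow> 'z \<Rightarrow> real) \<Rightarrow> ('z \<Rightarrow> 'z) \<Rightarrow> bool" where
  "Li_Yorke_chaotic Z d f \<longleftrightarrow> (\<exists>S. scrambled_set Z d f S \<and> uncountable S)"

definition densely_chaotic ::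
  "'z set \<Rightarrow> ('z \<Rightarrow> 'z \<Rightarrow> real) \<Rightarrow> ('z \<Rightarrow> 'z) \<Rightarrow> bool" where
  "densely_chaotic Z d f \<longleftrightarrow>
     prod_topology (Metric_space.mtopology Z d) (Metric_space.mtopology Z d)
       closure_of scrambled_pairs Z d f = Z \<times> Z"

definition topologically_transitive ::
  "'z set \<Rightarrow> ('z \<Rightarrow> 'z \<Rightarrow> real) \<Rightarrow> ('z \<Rightarrow> 'z) \<Rightarrow> bool" where
  "topologically_transitive Z d f \<longleftrightarrow>
     (\<forall>U V. openin (Metric_space.mtopology Z d) U \<and> U \<noteq> {} \<and>
            openin (Metric_space.mtopology Z d) V \<and> V \<noteq> {} \<longrightarrow>
            (\<exists>n\<ge>1. U \<inter> (f ^^ n) ` V \<noteq> {}))"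

definition sensitive ::
  "'z set \<Rightarrow> ('z \<Rightarrow> 'z \<Rightarrow> real) \<Rightarrow> ('z \<Rightarrow> 'z) \<Rightarrow> bool" where
  "sensitive Z d f \<longleftrightarrow>
     (\<exists>\<epsilon>>0. \<forall>x\<in>Z. \<forall>V. openin (Metric_space.mtopology Z d) V \<and> x \<in> V \<longrightarrow>
        (\<exists>n. \<exists>y\<in>V. d ((f ^^ n) x) ((f ^^ n) y) > \<epsilon>))"

definition periodic_points :: "'z set \<Rightarrow> ('z \<Rightarrow> 'z) \<Rightarrow> 'z set" where
  "periodic_points Z f = {z \<in> Z. \<exists>n\<ge>1. (f ^^ n) z = z}"

definition Devaney_chaotic ::
  "'z set \<Rightarrow> ('z \<Rightarrow> 'z \<Rightarrow> real) \<Rightarrow> ('z \<Rightarrow> 'z) \<Rightarrow> bool" where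
  "Devaney_chaotic Z d f \<longleftrightarrow>
     topologically_transitive Z d f \<and>
     Metric_space.mtopology Z d closure_of periodic_points Z f = Z \<and>
     sensitive Z d f"

section \<open>Generalized shifts\<close>

abbreviation config_space :: "'a set \<Rightarrow> 'g set \<Rightarrow> ('g \<Rightarrow> 'a) set" where
  "config_space X \<Gamma> \<equiv> \<Gamma> \<rightarrow>\<^sub>E X"

definition enum_indices :: "'g set \<Rightarrow> nat set" where
  "enum_indices \<Gamma> = (if finite \<Gamma> then {1..card \<Gamma>} else {1..})"

definition enumeration :: "(nat \<Rightarrow> 'g) \<Rightarrow> 'g set \<Rightarrow> bool" where
  "enumeration \<beta> \<Gamma> \<longleftrightarrow> bij_betw \<beta> (enum_indices \<Gamma>) \<Gamma>"

definition discrete_delta :: "'a \<Rightarrow> 'a \<Rightarrow> real" where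
  "discrete_delta a b = (if a = b then 0 else 1)"

definition config_dist ::
  "'g set \<Rightarrow> (nat \<Rightarrow> 'g) \<Rightarrow> ('g \<Rightarrow> 'a) \<Rightarrow> ('g \<Rightarrow> 'a) \<Rightarrow> real" where
  "config_dist \<Gamma> \<beta> x y =
     (\<Sum>\<^sub>\<infinity>n\<in>enum_indices \<Gamma>. discrete_delta (x (\<beta> n)) (y (\<beta> n)) / 2 ^ n)"

text \<open>Restricting to the configuration space makes equality of the HOL functions
  coincide with equality of the maps they represent.\<close>

definition gen_shift ::
  "'a set \<Rightarrow> 'g set \<Rightarrow> ('g \<Rightarrow> 'g) \<Rightarrow> ('g \<Rightarrow> 'a) \<Rightarrow> ('g \<Rightarrow> 'a)" where
  "gen_shift X \<Gamma> \<eta> = (\<lambda>x\<in>config_space X \<Gamma>. \<lambda>\<alpha>\<in>\<Gamma>. x (\<eta> \<alpha>))"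

type_synonym ('g, 'a) system = "('g \<Rightarrow> 'a) set \<times> (('g \<Rightarrow> 'a) \<Rightarrow> ('g \<Rightarrow> 'a))"

definition Devaney_class :: "'a set \<Rightarrow> 'g set \<Rightarrow> (nat \<Rightarrow> 'g) \<Rightarrow> ('g, 'a) system set" where
  "Devaney_class X \<Gamma> \<beta> = {(config_space X \<Gamma>, gen_shift X \<Gamma> \<eta>) | \<eta>.
     \<eta> \<in> \<Gamma> \<rightarrow> \<Gamma> \<and> Devaney_chaotic (config_space X \<Gamma>) (config_dist \<Gamma> \<beta>) (gen_shift X \<Gamma> \<eta>)}"

definition densely_class :: "'a set \<Rightarrow> 'g set \<Rightarrow> (nat \<Rightarrow> 'g) \<Rightarrow> ('g, 'a) system set" where
  "densely_class X \<Gamma> \<beta> = {(config_space X \<Gamma>, gen_shift X \<Gamma> \<eta>) | \<eta>.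
     \<eta> \<in> \<Gamma> \<rightarrow> \<Gamma> \<and> densely_chaotic (config_space X \<Gamma>) (config_dist \<Gamma> \<beta>) (gen_shift X \<Gamma> \<eta>)}"

definition Li_Yorke_class :: "'a set \<Rightarrow> 'g set \<Rightarrow> (nat \<Rightarrow> 'g) \<Rightarrow> ('g, 'a) system set" where
  "Li_Yorke_class X \<Gamma> \<beta> = {(config_space X \<Gamma>, gen_shift X \<Gamma> \<eta>) | \<eta>.
     \<eta> \<in> \<Gamma> \<rightarrow> \<Gamma> \<and> Li_Yorke_chaotic (config_space X \<Gamma>) (config_dist \<Gamma> \<beta>) (gen_shift X \<Gamma> \<eta>)}"

section \<open>The distance is a metric compatible with the product topology\<close>

text \<open>These facts justify evaluating the chaos notions in the metric topology.\<close>

lemma discrete_delta_bounds: "0 \<le> discrete_delta a b" "discrete_delta a b \<le> 1"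
  by (auto simp: discrete_delta_def)

lemma discrete_delta_commute: "discrete_delta a b = discrete_delta b a"
  by (auto simp: discrete_delta_def)

lemma half_has_sum: "((\<lambda>n. 1 / 2 ^ n :: real) has_sum 2) UNIV"
proof -
  have "(\<lambda>n. (1/2) ^ n :: real) sums 2"
    using geometric_sums[of "1/2 :: real"] by simp
  then have "(\<lambda>n. 1 / 2 ^ n :: real) sums 2"
    by (simp add: power_one_over)
  then show ?thesis
    by (intro sums_nonneg_imp_has_sum) auto
qed

lemma half_summable: "(\<lambda>n. 1 / 2 ^ n :: real) summable_on A"
  by (rule summable_on_subset_banach[OF has_sum_imp_summable[OF half_has_sum]]) simp

lemma config_dist_summable:
  "(\<lambda>n. discrete_delta (x (\<beta> n)) (y (\<beta> n)) / 2 ^ n) summable_on A"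
  by (rule summable_on_comparison_test[OF half_summable])
     (auto simp: discrete_delta_bounds divide_right_mono)

lemma config_dist_ge:
  assumes "n \<in> enum_indices \<Gamma>" "x (\<beta> n) \<noteq> y (\<beta> n)"
  shows "1 / 2 ^ n \<le> config_dist \<Gamma> \<beta> x y"
proof -
  have "(\<Sum>k\<in>{n}. discrete_delta (x (\<beta> k)) (y (\<beta> k)) / 2 ^ k) \<le> config_dist \<Gamma> \<beta> x y"
    unfolding config_dist_def
    by (rule finite_sum_le_infsum[OF config_dist_summable[of x \<beta> y]])
       (use assms in \<open>simp_all add: discrete_delta_bounds\<close>)
  then show ?thesis using assms by (simp add: discrete_delta_def)
qed

lemma config_dist_le:
  assumes "\<And>n. n \<in> enum_indices \<Gamma> \<Longrightarrow> n \<le> N \<Longrightarrow> x (\<beta> n) = y (\<beta> n)"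
  shows "config_dist \<Gamma> \<beta> x y \<le> 1 / 2 ^ N"
proof -
  have "((\<lambda>k. (1 / 2 ^ Suc N) * (1 / 2 ^ k)) has_sum (1 / 2 ^ Suc N * 2 :: real)) UNIV"
    by (intro has_sum_cmult_right half_has_sum)
  then have "(((\<lambda>n. 1 / 2 ^ n :: real) \<circ> (\<lambda>k. Suc N + k)) has_sum (1 / 2 ^ N)) UNIV"
    by (simp add: o_def power_add mult.assoc)
  then have "((\<lambda>n. 1 / 2 ^ n :: real) has_sum (1 / 2 ^ N)) (range (\<lambda>k. Suc N + k))"
    by (subst has_sum_reindex) (rule inj_onI, simp, assumption)
  then have tail: "(\<Sum>\<^sub>\<infinity>n\<in>range (\<lambda>k. Suc N + k). 1 / 2 ^ n :: real) = 1 / 2 ^ N"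
    by (rule infsumI)
  have "config_dist \<Gamma> \<beta> x y \<le> (\<Sum>\<^sub>\<infinity>n\<in>range (\<lambda>k. Suc N + k). 1 / 2 ^ n :: real)"
    unfolding config_dist_def
  proof (rule infsum_mono_neutral[OF config_dist_summable[of x \<beta> y] half_summable])
    fix n assume n: "n \<in> enum_indices \<Gamma> - range (\<lambda>k. Suc N + k)"
    have "n \<le> N"
    proof (rule ccontr)
      assume "\<not> n \<le> N"
      then have "n = Suc N + (n - Suc N)" by simp
      with n show False by blast
    qed
    with n assms show "discrete_delta (x (\<beta> n)) (y (\<beta> n)) / 2 ^ n \<le> 0"
      by (simp add: discrete_delta_def)
  qed (auto simp: discrete_delta_bounds divide_right_mono)
  with tail show ?thesis by simp
qed

lemma Metric_space_config:
  fixes X :: "'a set" and \<Gamma> :: "'g set"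
  assumes "enumeration \<beta> \<Gamma>"
  shows "Metric_space (config_space X \<Gamma>) (config_dist \<Gamma> \<beta>)"
proof
  fix x y z :: "'g \<Rightarrow> 'a"
  show "0 \<le> config_dist \<Gamma> \<beta> x y"
    unfolding config_dist_def by (intro infsum_nonneg) (auto simp: discrete_delta_bounds)
  show "config_dist \<Gamma> \<beta> x y = config_dist \<Gamma> \<beta> y x"
    unfolding config_dist_def by (simp add: discrete_delta_commute)
  show "config_dist \<Gamma> \<beta> x z \<le> config_dist \<Gamma> \<beta> x y + config_dist \<Gamma> \<beta> y z"
  proof -
    have "config_dist \<Gamma> \<beta> x z \<le>
        (\<Sum>\<^sub>\<infinity>n\<in>enum_indices \<Gamma>. discrete_delta (x (\<beta> n)) (y (\<beta> n)) / 2 ^ n +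
                                discrete_delta (y (\<beta> n)) (z (\<beta> n)) / 2 ^ n)"
      unfolding config_dist_def
    proof (rule infsum_mono)
      fix n
      have "discrete_delta (x (\<beta> n)) (z (\<beta> n)) \<le>
          discrete_delta (x (\<beta> n)) (y (\<beta> n)) + discrete_delta (y (\<beta> n)) (z (\<beta> n))"
        by (simp add: discrete_delta_def)
      then show "discrete_delta (x (\<beta> n)) (z (\<beta> n)) / 2 ^ n \<le>
          discrete_delta (x (\<beta> n)) (y (\<beta> n)) / 2 ^ n +
          discrete_delta (y (\<beta> n)) (z (\<beta> n)) / 2 ^ n"
        unfolding add_divide_distrib[symmetric] by (rule divide_right_mono) simp
    qed (rule config_dist_summable[of x \<beta> z]
        summable_on_add[OF config_dist_summable[of x \<beta> y] config_dist_summable[of y \<beta> z]])+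
    also have "\<dots> = config_dist \<Gamma> \<beta> x y + config_dist \<Gamma> \<beta> y z"
      unfolding config_dist_def
      by (rule infsum_add[OF config_dist_summable[of x \<beta> y] config_dist_summable[of y \<beta> z]])
    finally show ?thesis .
  qed
  assume x: "x \<in> config_space X \<Gamma>" and y: "y \<in> config_space X \<Gamma>"
  show "config_dist \<Gamma> \<beta> x y = 0 \<longleftrightarrow> x = y"
  proof
    assume 0: "config_dist \<Gamma> \<beta> x y = 0"
    have "x a = y a" if a: "a \<in> \<Gamma>" for a
    proof -
      obtain n where n: "n \<in> enum_indices \<Gamma>" "a = \<beta> n"
        using bij_betw_imp_surj_on[OF assms[unfolded enumeration_def]] a by blast
      have "\<not> 1 / 2 ^ n \<le> config_dist \<Gamma> \<beta> x y" by (simp add: 0 not_le)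
      with config_dist_ge[of n \<Gamma> x \<beta> y] n show ?thesis by metis
    qed
    with x y show "x = y" by (rule PiE_ext)
  qed (simp add: config_dist_def discrete_delta_def)
qed

lemma mtopology_config:
  assumes \<beta>: "enumeration \<beta> \<Gamma>"
  shows "Metric_space.mtopology (config_space X \<Gamma>) (config_dist \<Gamma> \<beta>) =
         product_topology (\<lambda>_. discrete_topology X) \<Gamma>"
proof -
  interpret Metric_space "config_space X \<Gamma>" "config_dist \<Gamma> \<beta>"
    by (rule Metric_space_config[OF \<beta>])
  have bij: "inj_on \<beta> (enum_indices \<Gamma>)" "\<beta> ` enum_indices \<Gamma> = \<Gamma>"
    using \<beta> by (auto simp: enumeration_def bij_betw_def)
  show ?thesis
    unfolding topology_eq
  proof (intro allI iffI)
    fix S assume S: "openin mtopology S"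
    show "openin (product_topology (\<lambda>_. discrete_topology X) \<Gamma>) S"
      unfolding openin_product_topology_alt
    proof
      fix x assume x: "x \<in> S"
      with S have xZ: "x \<in> config_space X \<Gamma>" unfolding openin_mtopology by blast
      from S x obtain r where r: "r > 0" "mball x r \<subseteq> S" unfolding openin_mtopology by blast
      obtain N where N: "(1/2 :: real) ^ N < r" using real_arch_pow_inv[OF r(1), of "1/2"] by auto
      define F where "F = \<beta> ` (enum_indices \<Gamma> \<inter> {..N})"
      define U where "U = (\<lambda>i. if i \<in> F then {x i} else X)"
      have "Pi\<^sub>E \<Gamma> U \<subseteq> S"
      proof
        fix y assume y: "y \<in> Pi\<^sub>E \<Gamma> U"
        have F: "F \<subseteq> \<Gamma>" using bij by (auto simp: F_def)
        have "U i \<subseteq> X" if "i \<in> \<Gamma>" for i using that xZ by (auto simp: U_def)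
        with y have yZ: "y \<in> config_space X \<Gamma>" by (meson PiE_mono subsetD)
        have yx: "y i = x i" if "i \<in> F" for i
        proof -
          have "y i \<in> U i" using y that F by blast
          then show ?thesis using that by (simp add: U_def)
        qed
        have "config_dist \<Gamma> \<beta> x y \<le> 1 / 2 ^ N"
          by (rule config_dist_le) (simp add: F_def yx)
        with N have "config_dist \<Gamma> \<beta> x y < r" by (simp add: power_one_over)
        with xZ yZ r show "y \<in> S" by auto
      qed
      moreover have "finite {i \<in> \<Gamma>. U i \<noteq> X}"
        by (rule finite_subset[of _ F]) (auto simp: U_def F_def)
      moreover have "\<forall>i\<in>\<Gamma>. U i \<subseteq> X" "x \<in> Pi\<^sub>E \<Gamma> U"
        using xZ by (auto simp: U_def PiE_iff)
      ultimately show "\<exists>U. finite {i \<in> \<Gamma>. U i \<noteq> topspace (discrete_topology X)} \<and>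
          (\<forall>i\<in>\<Gamma>. openin (discrete_topology X) (U i)) \<and> x \<in> Pi\<^sub>E \<Gamma> U \<and> Pi\<^sub>E \<Gamma> U \<subseteq> S"
        by (intro exI[of _ U]) simp
    qed
  next
    fix S assume S: "openin (product_topology (\<lambda>_. discrete_topology X) \<Gamma>) S"
    show "openin mtopology S"
      unfolding openin_mtopology
    proof (intro conjI allI impI)
      show SZ: "S \<subseteq> config_space X \<Gamma>" using openin_subset[OF S] by simp
      fix x assume x: "x \<in> S"
      with SZ have xZ: "x \<in> config_space X \<Gamma>" by blast
      from S x obtain U where U: "finite {i \<in> \<Gamma>. U i \<noteq> X}" "x \<in> Pi\<^sub>E \<Gamma> U" "Pi\<^sub>E \<Gamma> U \<subseteq> S"
        unfolding openin_product_topology_alt by force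
      define J where "J = {n \<in> enum_indices \<Gamma>. U (\<beta> n) \<noteq> X}"
      have "\<beta> ` J \<subseteq> {i \<in> \<Gamma>. U i \<noteq> X}" "inj_on \<beta> J"
        using bij by (auto simp: J_def inj_on_def)
      then have "finite J" using U(1) by (meson finite_imageD finite_subset)
      then obtain N where N: "\<forall>n\<in>J. n \<le> N" using finite_nat_set_iff_bounded_le by blast
      have "mball x (1 / 2 ^ N) \<subseteq> Pi\<^sub>E \<Gamma> U"
      proof
        fix y assume "y \<in> mball x (1 / 2 ^ N)"
        then have yZ: "y \<in> config_space X \<Gamma>" and xy: "config_dist \<Gamma> \<beta> x y < 1 / 2 ^ N" by auto
        have "y i \<in> U i" if i: "i \<in> \<Gamma>" for i
        proof (cases "U i = X")
          case True
          then show ?thesis using yZ i by auto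
        next
          case False
          obtain n where n: "n \<in> enum_indices \<Gamma>" "i = \<beta> n" using bij i by blast
          with False N have "n \<le> N" by (auto simp: J_def)
          then have "(1 :: real) / 2 ^ N \<le> 1 / 2 ^ n" by (simp add: frac_le)
          then have "x i = y i" using config_dist_ge[of n \<Gamma> x \<beta> y] n xy by fastforce
          then show ?thesis using U(2) i by (metis PiE_mem)
        qed
        then show "y \<in> Pi\<^sub>E \<Gamma> U" using yZ by (auto simp: PiE_iff)
      qed
      with U(3) show "\<exists>r>0. mball x r \<subseteq> S"
        by (intro exI[of _ "1 / 2 ^ N"]) auto
    qed
  qed
qed

lemma compact_space_config:
  assumes "enumeration \<beta> \<Gamma>" "finite X"
  shows "compact_space (Metric_space.mtopology (config_space X \<Gamma>) (config_dist \<Gamma> \<beta>))"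
  using assms by (simp add: mtopology_config compact_space_product_topology compact_space_discrete_topology)

lemma continuous_map_gen_shift:
  assumes "enumeration \<beta> \<Gamma>" "\<eta> \<in> \<Gamma> \<rightarrow> \<Gamma>"
  shows "continuous_map (Metric_space.mtopology (config_space X \<Gamma>) (config_dist \<Gamma> \<beta>))
           (Metric_space.mtopology (config_space X \<Gamma>) (config_dist \<Gamma> \<beta>)) (gen_shift X \<Gamma> \<eta>)"
proof -
  let ?T = "product_topology (\<lambda>_. discrete_topology X) \<Gamma>"
  have "continuous_map ?T (discrete_topology X) (\<lambda>x. gen_shift X \<Gamma> \<eta> x k)" if "k \<in> \<Gamma>" for k
  proof (rule continuous_map_eq)
    show "continuous_map ?T (discrete_topology X) (\<lambda>x. x (\<eta> k))"
      using assms(2) that by (intro continuous_map_product_projection) auto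
    show "x (\<eta> k) = gen_shift X \<Gamma> \<eta> x k" if "x \<in> topspace ?T" for x
      using that \<open>k \<in> \<Gamma>\<close> by (simp add: gen_shift_def)
  qed
  then have "continuous_map ?T ?T (gen_shift X \<Gamma> \<eta>)"
    unfolding continuous_map_componentwise by (auto simp: gen_shift_def)
  then show ?thesis by (simp add: mtopology_config[OF assms(1)])
qed

end

theory Submission
  imports Defs
begin

text \<open>
  The \<open>n\<close>-th iterate of \<open>\<sigma>\<^sub>\<eta>\<close> reads the coordinate \<open>\<eta>\<^sup>n(\<alpha>)\<close> in place of \<open>\<alpha>\<close>.  Hence
  whether a pair is scrambled only depends on how the \<open>\<eta>\<close>-orbits of finite sets of
  indices meet the set of indices at which the two configurations differ.  The chain of
  inclusions then passes through the dynamics of \<open>\<eta>\<close>: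

  \<^item> A topologically transitive shift (in particular a Devaney chaotic one) has an \<open>\<eta>\<close>
    without periodic points, because on a finite cycle a constant pattern can never turn into
    another constant pattern (\<open>transitive_imp_aperiodic\<close>).  For the same reason, points
    that carry different constants on a cycle never come close, so dense chaos also excludes
    cycles (\<open>densely_chaotic_imp_aperiodic\<close>).

  \<^item> If \<open>\<eta>\<close> has no periodic points, the shift is densely chaotic: outside a finite set of
    prescribed values, let two configurations differ exactly at the indices that \<open>\<alpha>\<close> reaches
    after \<open>2\<^sup>k\<close> steps, for a fixed \<open>\<alpha>\<close>.  The growing gaps between the powers of two
    leave arbitrarily long time spans in which a given finite set of indices sees no difference
    (\<open>powers_of_two_avoided\<close>), while \<open>\<alpha>\<close> itself sees a difference infinitely often
    (\<open>aperiodic_imp_densely_chaotic\<close>).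

  \<^item> If a single index has an infinite orbit, differences along the same sparse set,
    switched on according to a subset of \<open>\<nat>\<close> that is repeated infinitely often, give an
    uncountable scrambled set (\<open>infinite_orbit_imp_Li_Yorke\<close>).

  The inclusions are proper for infinite \<open>\<Gamma>\<close>: two indices with the same image destroy
  transitivity without creating a cycle, and a fixed point beside an infinite orbit destroys dense
  chaos but keeps Li--Yorke chaos.
\<close>

section \<open>Iterates and cylinder sets\<close>

definition aperiodic_on :: "'g set \<Rightarrow> ('g \<Rightarrow> 'g) \<Rightarrow> bool" where
  "aperiodic_on \<Gamma> \<eta> \<longleftrightarrow> (\<forall>\<alpha>\<in>\<Gamma>. \<forall>n\<ge>1. (\<eta> ^^ n) \<alpha> \<noteq> \<alpha>)"

definition cylinder :: "'a set \<Rightarrow> 'g set \<Rightarrow> 'g set \<Rightarrow> ('g \<Rightarrow> 'a) \<Rightarrow> ('g \<Rightarrow> 'a) set" where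
  "cylinder X \<Gamma> F p = {x \<in> config_space X \<Gamma>. \<forall>i\<in>F. x i = p i}"

lemma funpow_in_carrier:
  assumes "\<eta> \<in> \<Gamma> \<rightarrow> \<Gamma>" "\<alpha> \<in> \<Gamma>"
  shows "(\<eta> ^^ n) \<alpha> \<in> \<Gamma>"
  using assms by (induction n) auto

lemma gen_shift_funpow:
  assumes \<eta>: "\<eta> \<in> \<Gamma> \<rightarrow> \<Gamma>" and x: "x \<in> config_space X \<Gamma>"
  shows gen_shift_funpow_in: "(gen_shift X \<Gamma> \<eta> ^^ n) x \<in> config_space X \<Gamma>"
    and gen_shift_funpow_apply: "\<alpha> \<in> \<Gamma> \<Longrightarrow> (gen_shift X \<Gamma> \<eta> ^^ n) x \<alpha> = x ((\<eta> ^^ n) \<alpha>)"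
proof -
  have in_space: "(gen_shift X \<Gamma> \<eta> ^^ n) x \<in> config_space X \<Gamma>" for n
    using \<eta> x by (induction n) (auto simp: gen_shift_def PiE_iff)
  then show "(gen_shift X \<Gamma> \<eta> ^^ n) x \<in> config_space X \<Gamma>" .
  show "(gen_shift X \<Gamma> \<eta> ^^ n) x \<alpha> = x ((\<eta> ^^ n) \<alpha>)" if "\<alpha> \<in> \<Gamma>"
    using that
  proof (induction n arbitrary: \<alpha>)
    case (Suc n)
    have "\<eta> \<alpha> \<in> \<Gamma>" using \<eta> Suc.prems by auto
    then have "(gen_shift X \<Gamma> \<eta> ^^ Suc n) x \<alpha> = x ((\<eta> ^^ n) (\<eta> \<alpha>))"
      using Suc.IH[OF \<open>\<eta> \<alpha> \<in> \<Gamma>\<close>] Suc.prems in_space[of n]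
      by (simp add: gen_shift_def[of X \<Gamma> \<eta>, THEN fun_cong, of "(gen_shift X \<Gamma> \<eta> ^^ n) x"])
    then show ?case by (simp add: funpow_swap1)
  qed simp
qed

lemma openin_imp_cylinder:
  assumes \<beta>: "enumeration \<beta> \<Gamma>"
    and U: "openin (Metric_space.mtopology (config_space X \<Gamma>) (config_dist \<Gamma> \<beta>)) U"
    and p: "p \<in> U"
  obtains F where "finite F" "F \<subseteq> \<Gamma>" "cylinder X \<Gamma> F p \<subseteq> U"
proof -
  from U p obtain W where W: "finite {i \<in> \<Gamma>. W i \<noteq> X}" "p \<in> Pi\<^sub>E \<Gamma> W" "Pi\<^sub>E \<Gamma> W \<subseteq> U"
    unfolding mtopology_config[OF \<beta>] openin_product_topology_alt by force
  have "cylinder X \<Gamma> {i \<in> \<Gamma>. W i \<noteq> X} p \<subseteq> Pi\<^sub>E \<Gamma> W"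
  proof
    fix x assume x: "x \<in> cylinder X \<Gamma> {i \<in> \<Gamma>. W i \<noteq> X} p"
    have "x i \<in> W i" if "i \<in> \<Gamma>" for i
      using x W(2) that by (cases "W i = X") (auto simp: cylinder_def PiE_iff)
    with x show "x \<in> Pi\<^sub>E \<Gamma> W" by (auto simp: cylinder_def PiE_iff)
  qed
  with W show thesis by (intro that[of "{i \<in> \<Gamma>. W i \<noteq> X}"]) auto
qed

lemma openin_cylinder:
  assumes \<beta>: "enumeration \<beta> \<Gamma>" and F: "finite F" "F \<subseteq> \<Gamma>"
  shows "openin (Metric_space.mtopology (config_space X \<Gamma>) (config_dist \<Gamma> \<beta>)) (cylinder X \<Gamma> F p)"
  unfolding mtopology_config[OF \<beta>] openin_product_topology_alt
proof
  fix x assume x: "x \<in> cylinder X \<Gamma> F p"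
  define W where "W = (\<lambda>i. if i \<in> F then {x i} else X)"
  have "finite {i \<in> \<Gamma>. W i \<noteq> X}"
    by (rule finite_subset[OF _ F(1)]) (auto simp: W_def)
  moreover have W_le: "W i \<subseteq> X" if "i \<in> \<Gamma>" for i
    using x that by (auto simp: W_def cylinder_def PiE_iff simp del: Pi_iff)
  moreover have "x \<in> Pi\<^sub>E \<Gamma> W"
    using x by (auto simp: W_def cylinder_def PiE_iff)
  moreover have "Pi\<^sub>E \<Gamma> W \<subseteq> cylinder X \<Gamma> F p"
  proof
    fix y assume y: "y \<in> Pi\<^sub>E \<Gamma> W"
    then have "y \<in> config_space X \<Gamma>" using W_le by (auto simp: PiE_iff)
    moreover have "y i = p i" if "i \<in> F" for i
    proof -
      have "y i \<in> W i" using y that F by (auto simp: PiE_iff)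
      then show ?thesis using x that by (auto simp: W_def cylinder_def)
    qed
    ultimately show "y \<in> cylinder X \<Gamma> F p" by (simp add: cylinder_def)
  qed
  ultimately show "\<exists>U. finite {i \<in> \<Gamma>. U i \<noteq> topspace (discrete_topology X)} \<and>
      (\<forall>i\<in>\<Gamma>. openin (discrete_topology X) (U i)) \<and> x \<in> Pi\<^sub>E \<Gamma> U \<and> Pi\<^sub>E \<Gamma> U \<subseteq> cylinder X \<Gamma> F p"
    by (intro exI[of _ W]) simp
qed

lemma const_in_cylinder:
  assumes "a \<in> X" "F \<subseteq> \<Gamma>"
  shows "(\<lambda>_\<in>\<Gamma>. a) \<in> cylinder X \<Gamma> F (\<lambda>_. a)"
  using assms by (auto simp: cylinder_def)

section \<open>Scrambled pairs in terms of coordinates\<close>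

text \<open>Closeness of two configurations is agreement on a long initial segment of the enumeration,
  that is, on a large finite set; separation along a subsequence is disagreement at one fixed
  coordinate.\<close>

lemma scrambled_pairI:
  assumes \<beta>: "enumeration \<beta> \<Gamma>" and \<eta>: "\<eta> \<in> \<Gamma> \<rightarrow> \<Gamma>"
    and x: "x \<in> config_space X \<Gamma>" and y: "y \<in> config_space X \<Gamma>"
    and close: "\<And>F N. finite F \<Longrightarrow> F \<subseteq> \<Gamma> \<Longrightarrow> \<exists>n\<ge>N. \<forall>\<gamma>\<in>F. x ((\<eta> ^^ n) \<gamma>) = y ((\<eta> ^^ n) \<gamma>)"
    and \<alpha>: "\<alpha> \<in> \<Gamma>" and apart: "\<And>N. \<exists>n\<ge>N. x ((\<eta> ^^ n) \<alpha>) \<noteq> y ((\<eta> ^^ n) \<alpha>)"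
  shows "scrambled_pair (config_dist \<Gamma> \<beta>) (gen_shift X \<Gamma> \<eta>) x y"
proof -
  interpret Metric_space "config_space X \<Gamma>" "config_dist \<Gamma> \<beta>"
    by (rule Metric_space_config[OF \<beta>])
  define f where "f = gen_shift X \<Gamma> \<eta>"
  define D where "D n = config_dist \<Gamma> \<beta> ((f ^^ n) x) ((f ^^ n) y)" for n
  have fx: "(f ^^ n) x \<gamma> = x ((\<eta> ^^ n) \<gamma>)" and fy: "(f ^^ n) y \<gamma> = y ((\<eta> ^^ n) \<gamma>)"
    if "\<gamma> \<in> \<Gamma>" for n \<gamma>
    using that gen_shift_funpow_apply[OF \<eta>] x y by (auto simp: f_def)
  have img: "\<beta> ` enum_indices \<Gamma> = \<Gamma>"
    using \<beta> by (auto simp: enumeration_def bij_betw_def)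
  have small: "\<exists>n\<ge>N. D n \<le> 1 / 2 ^ M" for N M
  proof -
    let ?F = "\<beta> ` (enum_indices \<Gamma> \<inter> {..M})"
    have F: "finite ?F" "?F \<subseteq> \<Gamma>" using img by auto
    obtain n where n: "n \<ge> N" "\<forall>\<gamma>\<in>?F. x ((\<eta> ^^ n) \<gamma>) = y ((\<eta> ^^ n) \<gamma>)"
      using close[OF F] by blast
    have "D n \<le> 1 / 2 ^ M"
      unfolding D_def
    proof (rule config_dist_le)
      fix m assume m: "m \<in> enum_indices \<Gamma>" "m \<le> M"
      then have "\<beta> m \<in> \<Gamma>" "\<beta> m \<in> ?F" using img by auto
      with n fx fy show "(f ^^ n) x (\<beta> m) = (f ^^ n) y (\<beta> m)" by metis
    qed
    with n show ?thesis by blast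
  qed
  have "liminf (\<lambda>n. ereal (D n)) \<le> 0"
  proof (rule ccontr)
    assume "\<not> liminf (\<lambda>n. ereal (D n)) \<le> 0"
    then obtain r where r: "0 < ereal r" "ereal r < liminf (\<lambda>n. ereal (D n))"
      using ereal_dense2[of 0] by (auto simp: not_le)
    obtain M where M: "(1/2 :: real) ^ M < r"
      using real_arch_pow_inv[of r "1/2"] r(1) by auto
    obtain N where "\<forall>n\<ge>N. ereal r < ereal (D n)"
      using less_LiminfD[OF r(2)] by (auto simp: eventually_sequentially)
    with small[of N M] M show False by (force simp: power_one_over)
  qed
  moreover have "0 \<le> liminf (\<lambda>n. ereal (D n))"
    by (intro Liminf_bounded always_eventually) (simp add: D_def)
  moreover have "0 < limsup (\<lambda>n. ereal (D n))"
  proof -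
    obtain m where m: "m \<in> enum_indices \<Gamma>" "\<alpha> = \<beta> m" using img \<alpha> by blast
    have large: "\<exists>n\<ge>N. 1 / 2 ^ m \<le> D n" for N
    proof -
      obtain n where n: "n \<ge> N" "x ((\<eta> ^^ n) \<alpha>) \<noteq> y ((\<eta> ^^ n) \<alpha>)" using apart by blast
      then have "(f ^^ n) x (\<beta> m) \<noteq> (f ^^ n) y (\<beta> m)"
        using \<alpha> fx fy m(2) by metis
      then show ?thesis
        unfolding D_def using n(1) config_dist_ge[OF m(1)] by blast
    qed
    have "ereal (1 / 2 ^ m) \<le> limsup (\<lambda>n. ereal (D n))"
    proof (rule ccontr)
      assume "\<not> ?thesis"
      then have "eventually (\<lambda>n. ereal (D n) < ereal (1 / 2 ^ m)) sequentially"
        by (intro Limsup_lessD) (simp add: not_le)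
      then obtain N where "\<forall>n\<ge>N. D n < 1 / 2 ^ m" by (auto simp: eventually_sequentially)
      with large[of N] show False by (meson not_le)
    qed
    moreover have "0 < ereal (1 / 2 ^ m)" by simp
    ultimately show ?thesis by (rule less_le_trans[rotated])
  qed
  ultimately show ?thesis
    unfolding scrambled_pair_def D_def f_def by (simp add: antisym)
qed

lemma scrambled_pair_agree:
  assumes \<beta>: "enumeration \<beta> \<Gamma>" and \<eta>: "\<eta> \<in> \<Gamma> \<rightarrow> \<Gamma>"
    and x: "x \<in> config_space X \<Gamma>" and y: "y \<in> config_space X \<Gamma>"
    and scr: "scrambled_pair (config_dist \<Gamma> \<beta>) (gen_shift X \<Gamma> \<eta>) x y"
    and \<alpha>: "\<alpha> \<in> \<Gamma>"
  shows "\<exists>n. x ((\<eta> ^^ n) \<alpha>) = y ((\<eta> ^^ n) \<alpha>)"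
proof (rule ccontr)
  assume never: "\<nexists>n. x ((\<eta> ^^ n) \<alpha>) = y ((\<eta> ^^ n) \<alpha>)"
  let ?f = "gen_shift X \<Gamma> \<eta>"
  obtain m where m: "m \<in> enum_indices \<Gamma>" "\<alpha> = \<beta> m"
    using \<alpha> \<beta> unfolding enumeration_def bij_betw_def by blast
  have "1 / 2 ^ m \<le> config_dist \<Gamma> \<beta> ((?f ^^ n) x) ((?f ^^ n) y)" for n
  proof (rule config_dist_ge[OF m(1)])
    show "(?f ^^ n) x (\<beta> m) \<noteq> (?f ^^ n) y (\<beta> m)"
      using never gen_shift_funpow_apply[OF \<eta> x \<alpha>] gen_shift_funpow_apply[OF \<eta> y \<alpha>]
      by (simp add: m(2))
  qed
  then have "ereal (1 / 2 ^ m) \<le>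
      liminf (\<lambda>n. ereal (config_dist \<Gamma> \<beta> ((?f ^^ n) x) ((?f ^^ n) y)))"
    by (intro Liminf_bounded always_eventually) simp
  then have "1 / 2 ^ m \<le> (0 :: real)" using scr by (simp add: scrambled_pair_def zero_ereal_def)
  moreover have "0 < 1 / (2 :: real) ^ m" by simp
  ultimately show False by linarith
qed

section \<open>Obstructions to transitivity and to dense chaos\<close>

lemma not_aperiodicE:
  assumes "\<not> aperiodic_on \<Gamma> \<eta>" "\<eta> \<in> \<Gamma> \<rightarrow> \<Gamma>"
  obtains \<alpha> C where "\<alpha> \<in> \<Gamma>" "finite C" "C \<subseteq> \<Gamma>" "\<And>n. (\<eta> ^^ n) \<alpha> \<in> C"
proof -
  from assms obtain \<alpha> p where \<alpha>: "\<alpha> \<in> \<Gamma>" "p \<ge> 1" "(\<eta> ^^ p) \<alpha> = \<alpha>"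
    by (auto simp: aperiodic_on_def)
  have "range (\<lambda>n. (\<eta> ^^ n) \<alpha>) \<subseteq> (\<lambda>n. (\<eta> ^^ n) \<alpha>) ` {..<p}"
  proof
    fix z assume "z \<in> range (\<lambda>n. (\<eta> ^^ n) \<alpha>)"
    then obtain n where "z = (\<eta> ^^ n) \<alpha>" by blast
    then have "z = (\<eta> ^^ (n mod p)) \<alpha>" using funpow_mod_eq[OF \<alpha>(3)] by metis
    moreover have "n mod p < p" using \<alpha>(2) by simp
    ultimately show "z \<in> (\<lambda>n. (\<eta> ^^ n) \<alpha>) ` {..<p}" by blast
  qed
  then have "finite (range (\<lambda>n. (\<eta> ^^ n) \<alpha>))" by (rule finite_subset) simp
  then show thesis
    using that[of \<alpha> "range (\<lambda>n. (\<eta> ^^ n) \<alpha>)"] \<alpha>(1) funpow_in_carrier[OF assms(2) \<alpha>(1)] by blast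
qed

lemma transitive_cylinders:
  assumes \<beta>: "enumeration \<beta> \<Gamma>"
    and trans: "topologically_transitive (config_space X \<Gamma>) (config_dist \<Gamma> \<beta>) f"
    and F: "finite F" "F \<subseteq> \<Gamma>" "cylinder X \<Gamma> F p \<noteq> {}"
    and G: "finite G" "G \<subseteq> \<Gamma>" "cylinder X \<Gamma> G q \<noteq> {}"
  obtains n x where "n \<ge> 1" "x \<in> cylinder X \<Gamma> G q" "(f ^^ n) x \<in> cylinder X \<Gamma> F p"
proof -
  have "\<exists>n\<ge>1. cylinder X \<Gamma> F p \<inter> (f ^^ n) ` cylinder X \<Gamma> G q \<noteq> {}"
    using trans openin_cylinder[OF \<beta> F(1,2), of X p] openin_cylinder[OF \<beta> G(1,2), of X q] F(3) G(3)
    unfolding topologically_transitive_def by simp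
  then show thesis using that by blast
qed

text \<open>On a finite set \<open>C\<close> that carries a whole orbit, a configuration constantly \<open>b\<close> shows \<open>b\<close>
  at \<open>\<alpha>\<close> forever, so the cylinder of the constant \<open>a\<close> is never reached.\<close>

lemma transitive_imp_aperiodic:
  assumes \<beta>: "enumeration \<beta> \<Gamma>" and \<eta>: "\<eta> \<in> \<Gamma> \<rightarrow> \<Gamma>"
    and ab: "a \<in> X" "b \<in> X" "a \<noteq> b"
    and trans: "topologically_transitive (config_space X \<Gamma>) (config_dist \<Gamma> \<beta>) (gen_shift X \<Gamma> \<eta>)"
  shows "aperiodic_on \<Gamma> \<eta>"
proof (rule ccontr)
  assume "\<not> aperiodic_on \<Gamma> \<eta>"
  then obtain \<alpha> C where \<alpha>: "\<alpha> \<in> \<Gamma>"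
    and C: "finite C" "C \<subseteq> \<Gamma>" and orbit: "\<And>n. (\<eta> ^^ n) \<alpha> \<in> C"
    using \<eta> not_aperiodicE by metis
  let ?cyl = "\<lambda>c. cylinder X \<Gamma> C (\<lambda>_. c)"
  have const: "(\<lambda>_\<in>\<Gamma>. c) \<in> ?cyl c" if "c \<in> X" for c
    using that C(2) by (rule const_in_cylinder)
  have "?cyl a \<noteq> {}" "?cyl b \<noteq> {}" using const ab(1,2) by auto
  then obtain n x where x: "x \<in> ?cyl b" "(gen_shift X \<Gamma> \<eta> ^^ n) x \<in> ?cyl a"
    using transitive_cylinders[OF \<beta> trans C _ C] by metis
  have "(gen_shift X \<Gamma> \<eta> ^^ n) x \<alpha> = a"
    using x(2) orbit[of 0] by (simp add: cylinder_def)
  then have "x ((\<eta> ^^ n) \<alpha>) = a"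
    using x(1) gen_shift_funpow_apply[OF \<eta> _ \<alpha>, of x X n] by (simp add: cylinder_def)
  with x(1) orbit[of n] ab(3) show False by (simp add: cylinder_def)
qed

text \<open>Near the pair of constants \<open>a\<close> and \<open>b\<close>, both components keep different symbols along a
  cycle, so their distance is bounded away from 0 and the pair is not scrambled.\<close>

lemma densely_chaotic_imp_aperiodic:
  assumes \<beta>: "enumeration \<beta> \<Gamma>" and \<eta>: "\<eta> \<in> \<Gamma> \<rightarrow> \<Gamma>"
    and ab: "a \<in> X" "b \<in> X" "a \<noteq> b"
    and dense: "densely_chaotic (config_space X \<Gamma>) (config_dist \<Gamma> \<beta>) (gen_shift X \<Gamma> \<eta>)"
  shows "aperiodic_on \<Gamma> \<eta>"
proof (rule ccontr)
  assume "\<not> aperiodic_on \<Gamma> \<eta>"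
  then obtain \<alpha> C where \<alpha>: "\<alpha> \<in> \<Gamma>"
    and C: "finite C" "C \<subseteq> \<Gamma>" and orbit: "\<And>n. (\<eta> ^^ n) \<alpha> \<in> C"
    using \<eta> not_aperiodicE by metis
  let ?cyl = "\<lambda>c. cylinder X \<Gamma> C (\<lambda>_. c)"
  have const: "(\<lambda>_\<in>\<Gamma>. c) \<in> ?cyl c" if "c \<in> X" for c
    using that C(2) by (rule const_in_cylinder)
  let ?T = "Metric_space.mtopology (config_space X \<Gamma>) (config_dist \<Gamma> \<beta>)"
  let ?p = "(\<lambda>_\<in>\<Gamma>. a, \<lambda>_\<in>\<Gamma>. b)"
  have p: "?p \<in> ?cyl a \<times> ?cyl b" using const ab(1,2) by auto
  have "?p \<in> config_space X \<Gamma> \<times> config_space X \<Gamma>" using ab by auto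
  then have closure: "?p \<in> prod_topology ?T ?T closure_of
      scrambled_pairs (config_space X \<Gamma>) (config_dist \<Gamma> \<beta>) (gen_shift X \<Gamma> \<eta>)"
    using dense unfolding densely_chaotic_def by simp
  have "openin (prod_topology ?T ?T) (?cyl a \<times> ?cyl b)"
    using openin_cylinder[OF \<beta> C, of X] by (simp add: openin_prod_Times_iff)
  with p closure obtain z where
    "z \<in> scrambled_pairs (config_space X \<Gamma>) (config_dist \<Gamma> \<beta>) (gen_shift X \<Gamma> \<eta>)"
    and "z \<in> ?cyl a \<times> ?cyl b"
    unfolding in_closure_of by meson
  then obtain x y where xy: "x \<in> ?cyl a" "y \<in> ?cyl b"
    and "x \<in> config_space X \<Gamma>" "y \<in> config_space X \<Gamma>"
    and "scrambled_pair (config_dist \<Gamma> \<beta>) (gen_shift X \<Gamma> \<eta>) x y"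
    by (auto simp: scrambled_pairs_def)
  then obtain n where "x ((\<eta> ^^ n) \<alpha>) = y ((\<eta> ^^ n) \<alpha>)"
    using scrambled_pair_agree[OF \<beta> \<eta> _ _ _ \<alpha>] by blast
  with xy orbit[of n] ab(3) show False by (simp add: cylinder_def)
qed

text \<open>If \<open>\<eta>\<close> identifies two indices, every image configuration has equal symbols there, so a
  cylinder prescribing different ones is missed by all iterates with \<open>n \<ge> 1\<close>.\<close>

lemma transitive_imp_inj_on:
  assumes \<beta>: "enumeration \<beta> \<Gamma>" and \<eta>: "\<eta> \<in> \<Gamma> \<rightarrow> \<Gamma>"
    and ab: "a \<in> X" "b \<in> X" "a \<noteq> b"
    and trans: "topologically_transitive (config_space X \<Gamma>) (config_dist \<Gamma> \<beta>) (gen_shift X \<Gamma> \<eta>)"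
  shows "inj_on \<eta> \<Gamma>"
proof (rule inj_onI, rule ccontr)
  fix \<alpha> \<gamma> assume \<alpha>: "\<alpha> \<in> \<Gamma>" and \<gamma>: "\<gamma> \<in> \<Gamma>" and eq: "\<eta> \<alpha> = \<eta> \<gamma>" and ne: "\<alpha> \<noteq> \<gamma>"
  let ?p = "\<lambda>i\<in>\<Gamma>. if i = \<alpha> then a else b"
  let ?U = "cylinder X \<Gamma> {\<alpha>, \<gamma>} ?p" and ?V = "cylinder X \<Gamma> {} ?p"
  have F: "finite {\<alpha>, \<gamma>}" "{\<alpha>, \<gamma>} \<subseteq> \<Gamma>" using \<alpha> \<gamma> by auto
  have "?p \<in> ?U" "?p \<in> ?V" using ab by (auto simp: cylinder_def)
  then have "?U \<noteq> {}" "?V \<noteq> {}" by blast+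
  then obtain n x where n: "n \<ge> 1" and "x \<in> ?V" "(gen_shift X \<Gamma> \<eta> ^^ n) x \<in> ?U"
    using transitive_cylinders[OF \<beta> trans F _ finite.emptyI empty_subsetI] by metis
  then have x: "x \<in> config_space X \<Gamma>" "(gen_shift X \<Gamma> \<eta> ^^ n) x \<in> ?U"
    by (simp_all add: cylinder_def)
  obtain m where "n = Suc m" using n by (cases n) auto
  then have "(\<eta> ^^ n) \<alpha> = (\<eta> ^^ n) \<gamma>" by (simp add: funpow_swap1 eq)
  moreover have "x ((\<eta> ^^ n) \<alpha>) = a" "x ((\<eta> ^^ n) \<gamma>) = b"
    using x \<alpha> \<gamma> ne gen_shift_funpow_apply[OF \<eta> x(1)] by (auto simp: cylinder_def)
  ultimately show False using ab(3) by simp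
qed

section \<open>Sparse differences along an infinite orbit\<close>

text \<open>The orbit of an index \<open>\<gamma>\<close> either misses the orbit of \<open>\<alpha>\<close> or runs along it with a fixed
  time lag, by injectivity of the latter.  So a finite set \<open>F\<close> has a bound \<open>C\<close> on all lags,
  and a time \<open>C + 1\<close> after a power of two much larger than \<open>C\<close> stays away from all powers of
  two by more than \<open>C\<close>.\<close>

lemma powers_of_two_avoided:
  fixes \<eta> :: "'g \<Rightarrow> 'g"
  assumes inj: "inj (\<lambda>n. (\<eta> ^^ n) \<alpha>)" and F: "finite F"
  shows "\<exists>n\<ge>N. \<forall>\<gamma>\<in>F. \<forall>k. (\<eta> ^^ n) \<gamma> \<noteq> (\<eta> ^^ (2 ^ k)) \<alpha>"
proof -
  have "\<exists>C. \<forall>n m. (\<eta> ^^ n) \<gamma> = (\<eta> ^^ m) \<alpha> \<longrightarrow> n \<le> m + C \<and> m \<le> n + C" for \<gamma>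
  proof (cases "\<exists>i j. (\<eta> ^^ i) \<gamma> = (\<eta> ^^ j) \<alpha>")
    case True
    then obtain i j where ij: "(\<eta> ^^ i) \<gamma> = (\<eta> ^^ j) \<alpha>" by blast
    have "n + j = m + i" if nm: "(\<eta> ^^ n) \<gamma> = (\<eta> ^^ m) \<alpha>" for n m
    proof -
      have "(\<eta> ^^ (n + j)) \<alpha> = (\<eta> ^^ n) ((\<eta> ^^ i) \<gamma>)" by (simp add: funpow_add ij)
      also have "\<dots> = (\<eta> ^^ (i + n)) \<gamma>" by (subst add.commute) (simp add: funpow_add)
      also have "\<dots> = (\<eta> ^^ (i + m)) \<alpha>" by (simp add: funpow_add nm)
      finally have "(\<eta> ^^ (n + j)) \<alpha> = (\<eta> ^^ (m + i)) \<alpha>" by (simp only: add.commute)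
      then show ?thesis using injD[OF inj] by blast
    qed
    then show ?thesis by (intro exI[of _ "i + j"]) force
  qed blast
  then obtain lag where lag: "\<And>\<gamma> n m. (\<eta> ^^ n) \<gamma> = (\<eta> ^^ m) \<alpha> \<Longrightarrow> n \<le> m + lag \<gamma> \<and> m \<le> n + lag \<gamma>"
    by metis
  define C where "C = sum lag F"
  have C: "n \<le> m + C \<and> m \<le> n + C" if "\<gamma> \<in> F" "(\<eta> ^^ n) \<gamma> = (\<eta> ^^ m) \<alpha>" for \<gamma> n m
    using lag[OF that(2)] member_le_sum[OF that(1), of lag] F by (fastforce simp: C_def)
  define K where "K = N + 2 * C + 2"
  have K: "K < 2 ^ K" by (rule less_exp)
  have "(\<eta> ^^ (2 ^ K + C + 1)) \<gamma> \<noteq> (\<eta> ^^ (2 ^ k)) \<alpha>" if "\<gamma> \<in> F" for \<gamma> k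
  proof
    assume "(\<eta> ^^ (2 ^ K + C + 1)) \<gamma> = (\<eta> ^^ (2 ^ k)) \<alpha>"
    note lags = C[OF that this]
    show False
    proof (cases "k \<le> K")
      case True
      then have "(2::nat) ^ k \<le> 2 ^ K" by (intro power_increasing) auto
      with lags show False by linarith
    next
      case False
      then have "(2::nat) ^ Suc K \<le> 2 ^ k" by (intro power_increasing) auto
      with lags K show False by (simp add: K_def)
    qed
  qed
  moreover have "N \<le> 2 ^ K + C + 1" using K by (simp add: K_def)
  ultimately show ?thesis by blast
qed

lemma aperiodic_imp_inj_orbit:
  assumes "aperiodic_on \<Gamma> \<eta>" "\<eta> \<in> \<Gamma> \<rightarrow> \<Gamma>" "\<alpha> \<in> \<Gamma>"
  shows "inj (\<lambda>n. (\<eta> ^^ n) \<alpha>)"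
proof (rule linorder_injI)
  fix m n :: nat assume "m < n"
  then have "(\<eta> ^^ n) \<alpha> = (\<eta> ^^ (n - m)) ((\<eta> ^^ m) \<alpha>)"
    using funpow_add[of "n - m" m \<eta>] by simp
  moreover have "(\<eta> ^^ (n - m)) ((\<eta> ^^ m) \<alpha>) \<noteq> (\<eta> ^^ m) \<alpha>"
    using assms(1) funpow_in_carrier[OF assms(2,3), of m] \<open>m < n\<close>
    unfolding aperiodic_on_def by (metis One_nat_def Suc_leI zero_less_diff)
  ultimately show "(\<eta> ^^ m) \<alpha> \<noteq> (\<eta> ^^ n) \<alpha>" by simp
qed

lemma inj_orbit_leaves_finite:
  assumes "inj (\<lambda>n. (\<eta> ^^ n) \<alpha>)" "finite H"
  shows "eventually (\<lambda>n. (\<eta> ^^ n) \<alpha> \<notin> H) sequentially"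
proof -
  have "finite ((\<lambda>n. (\<eta> ^^ n) \<alpha>) -` H)" by (rule finite_vimageI[OF assms(2,1)])
  then obtain N where "\<forall>n\<in>(\<lambda>n. (\<eta> ^^ n) \<alpha>) -` H. n < N"
    by (auto simp: finite_nat_set_iff_bounded)
  then show ?thesis unfolding eventually_sequentially by (meson not_le vimageI2)
qed

text \<open>The symbols prescribed by a basic neighbourhood sit in a finite set \<open>H\<close>.  Without cycles,
  every index leaves \<open>H\<close> for good, so only the sparse differences outside \<open>H\<close> matter in the
  long run.\<close>

lemma aperiodic_imp_densely_chaotic:
  fixes \<Gamma> :: "'g set" and X :: "'a set"
  assumes \<beta>: "enumeration \<beta> \<Gamma>" and \<eta>: "\<eta> \<in> \<Gamma> \<rightarrow> \<Gamma>"
    and ab: "a \<in> X" "b \<in> X" "a \<noteq> b"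
    and "\<Gamma> \<noteq> {}" and aper: "aperiodic_on \<Gamma> \<eta>"
  shows "densely_chaotic (config_space X \<Gamma>) (config_dist \<Gamma> \<beta>) (gen_shift X \<Gamma> \<eta>)"
proof -
  interpret Metric_space "config_space X \<Gamma>" "config_dist \<Gamma> \<beta>"
    by (rule Metric_space_config[OF \<beta>])
  let ?Z = "config_space X \<Gamma>"
  let ?S = "scrambled_pairs ?Z (config_dist \<Gamma> \<beta>) (gen_shift X \<Gamma> \<eta>)"
  obtain \<alpha> where \<alpha>: "\<alpha> \<in> \<Gamma>" using \<open>\<Gamma> \<noteq> {}\<close> by blast
  note inj = aperiodic_imp_inj_orbit[OF aper \<eta>]
  have meet: "\<exists>z\<in>?S. z \<in> T" if pq: "p \<in> ?Z" "q \<in> ?Z" "(p, q) \<in> T"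
    and T: "openin (prod_topology mtopology mtopology) T" for p q T
  proof -
    obtain U V where UV: "openin mtopology U" "openin mtopology V" "p \<in> U" "q \<in> V" "U \<times> V \<subseteq> T"
      using T pq(3) unfolding openin_prod_topology_alt by meson
    obtain F where F: "finite F" "F \<subseteq> \<Gamma>" "cylinder X \<Gamma> F p \<subseteq> U"
      using openin_imp_cylinder[OF \<beta> UV(1,3)] .
    obtain G where G: "finite G" "G \<subseteq> \<Gamma>" "cylinder X \<Gamma> G q \<subseteq> V"
      using openin_imp_cylinder[OF \<beta> UV(2,4)] .
    define H where "H = F \<union> G"
    have H: "finite H" using F G by (simp add: H_def)
    define x where "x = (\<lambda>i\<in>\<Gamma>. if i \<in> H then p i else a)"
    define y where "y = (\<lambda>i\<in>\<Gamma>. if i \<in> H then q i else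
                            if i \<in> range (\<lambda>k. (\<eta> ^^ (2 ^ k)) \<alpha>) then b else a)"
    have xZ: "x \<in> ?Z" and yZ: "y \<in> ?Z" using pq ab by (auto simp: x_def y_def)
    have "scrambled_pair (config_dist \<Gamma> \<beta>) (gen_shift X \<Gamma> \<eta>) x y"
    proof (rule scrambled_pairI[OF \<beta> \<eta> xZ yZ _ \<alpha>])
      fix F' N assume F': "finite F'" "F' \<subseteq> \<Gamma>"
      have "eventually (\<lambda>n. \<forall>\<gamma>\<in>F'. (\<eta> ^^ n) \<gamma> \<notin> H) sequentially"
        using F' inj_orbit_leaves_finite[OF inj H] by (intro eventually_ball_finite) blast+
      then obtain N' where N': "\<And>n \<gamma>. n \<ge> N' \<Longrightarrow> \<gamma> \<in> F' \<Longrightarrow> (\<eta> ^^ n) \<gamma> \<notin> H"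
        by (auto simp: eventually_sequentially)
      obtain n where n: "n \<ge> max N N'" "\<forall>\<gamma>\<in>F'. \<forall>k. (\<eta> ^^ n) \<gamma> \<noteq> (\<eta> ^^ (2 ^ k)) \<alpha>"
        using powers_of_two_avoided[OF inj[OF \<alpha>] F'(1)] by blast
      have "x ((\<eta> ^^ n) \<gamma>) = y ((\<eta> ^^ n) \<gamma>)" if "\<gamma> \<in> F'" for \<gamma>
      proof -
        have "(\<eta> ^^ n) \<gamma> \<notin> H" using N'[OF _ that] n(1) by simp
        moreover have "(\<eta> ^^ n) \<gamma> \<notin> range (\<lambda>k. (\<eta> ^^ (2 ^ k)) \<alpha>)" using n(2) that by blast
        ultimately show ?thesis by (simp add: x_def y_def)
      qed
      with n(1) show "\<exists>n\<ge>N. \<forall>\<gamma>\<in>F'. x ((\<eta> ^^ n) \<gamma>) = y ((\<eta> ^^ n) \<gamma>)" by auto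
    next
      fix N
      obtain N' where N': "\<And>n. n \<ge> N' \<Longrightarrow> (\<eta> ^^ n) \<alpha> \<notin> H"
        using inj_orbit_leaves_finite[OF inj[OF \<alpha>] H] by (auto simp: eventually_sequentially)
      define n :: nat where "n = 2 ^ (N + N')"
      have n: "n \<ge> N" "n \<ge> N'" using less_exp[of "N + N'"] unfolding n_def by linarith+
      have "(\<eta> ^^ n) \<alpha> \<in> range (\<lambda>k. (\<eta> ^^ (2 ^ k)) \<alpha>)" by (auto simp: n_def)
      then have "x ((\<eta> ^^ n) \<alpha>) \<noteq> y ((\<eta> ^^ n) \<alpha>)"
        using N'[OF n(2)] funpow_in_carrier[OF \<eta> \<alpha>] ab by (simp add: x_def y_def)
      with n show "\<exists>n\<ge>N. x ((\<eta> ^^ n) \<alpha>) \<noteq> y ((\<eta> ^^ n) \<alpha>)" by blast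
    qed
    moreover have "x \<in> cylinder X \<Gamma> F p" "y \<in> cylinder X \<Gamma> G q"
      using xZ yZ F(2) G(2) by (auto simp: cylinder_def x_def y_def H_def)
    ultimately show ?thesis
      using xZ yZ F(3) G(3) UV(5)
      by (intro bexI[of _ "(x, y)"]) (auto simp: scrambled_pairs_def)
  qed
  have "prod_topology mtopology mtopology closure_of ?S = ?Z \<times> ?Z"
  proof
    show "prod_topology mtopology mtopology closure_of ?S \<subseteq> ?Z \<times> ?Z"
      using closure_of_subset_topspace[of "prod_topology mtopology mtopology" ?S] by simp
    show "?Z \<times> ?Z \<subseteq> prod_topology mtopology mtopology closure_of ?S"
    proof (intro subsetI, elim SigmaE)
      fix z p q assume pq: "p \<in> ?Z" "q \<in> ?Z" and z: "z = (p, q)"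
      show "z \<in> prod_topology mtopology mtopology closure_of ?S"
        unfolding in_closure_of z
      proof (intro conjI allI impI)
        show "(p, q) \<in> topspace (prod_topology mtopology mtopology)" using pq by simp
        fix T assume "(p, q) \<in> T \<and> openin (prod_topology mtopology mtopology) T"
        then show "\<exists>z. z \<in> ?S \<and> z \<in> T" using meet[OF pq] by (simp only: Bex_def)
      qed
    qed
  qed
  then show ?thesis by (simp add: densely_chaotic_def)
qed

lemma infinite_orbit_imp_Li_Yorke:
  fixes \<Gamma> :: "'g set" and X :: "'a set"
  assumes \<beta>: "enumeration \<beta> \<Gamma>" and \<eta>: "\<eta> \<in> \<Gamma> \<rightarrow> \<Gamma>"
    and ab: "a \<in> X" "b \<in> X" "a \<noteq> b"
    and \<alpha>: "\<alpha> \<in> \<Gamma>" and inj: "inj (\<lambda>n. (\<eta> ^^ n) \<alpha>)"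
  shows "Li_Yorke_chaotic (config_space X \<Gamma>) (config_dist \<Gamma> \<beta>) (gen_shift X \<Gamma> \<eta>)"
proof -
  let ?Z = "config_space X \<Gamma>"
  define w :: "nat \<Rightarrow> 'g" where "w k = (\<eta> ^^ (2 ^ k)) \<alpha>" for k
  have w: "w k \<in> \<Gamma>" for k unfolding w_def by (rule funpow_in_carrier[OF \<eta> \<alpha>])
  have inj_w: "inj w" unfolding w_def by (rule injI) (use injD[OF inj] in force)
  \<comment> \<open>Decoding \<open>k\<close> to a pair repeats the membership of each number in \<open>s\<close> infinitely often, so
    different sets yield configurations that differ infinitely often.\<close>
  define c :: "nat set \<Rightarrow> 'g \<Rightarrow> 'a" where
    "c s = (\<lambda>i\<in>\<Gamma>. if \<exists>k. i = w k \<and> fst (prod_decode k) \<in> s then b else a)" for s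
  have c_Z: "c s \<in> ?Z" for s using ab by (auto simp: c_def)
  have c_w: "c s (w k) = (if fst (prod_decode k) \<in> s then b else a)" for s k
    using w injD[OF inj_w] by (auto simp: c_def)
  have scr: "scrambled_pair (config_dist \<Gamma> \<beta>) (gen_shift X \<Gamma> \<eta>) (c s) (c t)" if st: "s \<noteq> t" for s t
  proof (rule scrambled_pairI[OF \<beta> \<eta> c_Z c_Z _ \<alpha>])
    fix F N assume F: "finite F" "F \<subseteq> \<Gamma>"
    obtain n where n: "n \<ge> N" "\<forall>\<gamma>\<in>F. \<forall>k. (\<eta> ^^ n) \<gamma> \<noteq> w k"
      using powers_of_two_avoided[OF inj F(1)] unfolding w_def by blast
    then have "\<forall>\<gamma>\<in>F. c s ((\<eta> ^^ n) \<gamma>) = c t ((\<eta> ^^ n) \<gamma>)" by (auto simp: c_def)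
    with n show "\<exists>n\<ge>N. \<forall>\<gamma>\<in>F. c s ((\<eta> ^^ n) \<gamma>) = c t ((\<eta> ^^ n) \<gamma>)" by blast
  next
    fix N
    obtain i where i: "i \<in> s \<longleftrightarrow> i \<notin> t" using st by blast
    define k where "k = prod_encode (i, N)"
    have "c s (w k) \<noteq> c t (w k)" using i ab(3) by (auto simp: c_w k_def)
    moreover have "N \<le> 2 ^ k"
      using le_prod_encode_2[of N i] less_exp[of k] unfolding k_def by linarith
    ultimately show "\<exists>n\<ge>N. c s ((\<eta> ^^ n) \<alpha>) \<noteq> c t ((\<eta> ^^ n) \<alpha>)" unfolding w_def by blast
  qed
  have inj_c: "inj c"
  proof (rule injI)
    fix s t assume eq: "c s = c t"
    have "i \<in> s \<longleftrightarrow> i \<in> t" for i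
      using c_w[of s "prod_encode (i, 0)"] c_w[of t "prod_encode (i, 0)"] eq ab(3)
      by (auto split: if_splits)
    then show "s = t" by blast
  qed
  then have "c {} \<noteq> c UNIV" by (auto dest: injD)
  have "scrambled_set ?Z (config_dist \<Gamma> \<beta>) (gen_shift X \<Gamma> \<eta>) (range c)"
    unfolding scrambled_set_def
  proof (intro conjI ballI impI)
    show "range c \<subseteq> ?Z" using c_Z by (rule image_subsetI)
    show "\<exists>x\<in>range c. \<exists>y\<in>range c. x \<noteq> y" using \<open>c {} \<noteq> c UNIV\<close> by (meson rangeI)
    fix x y assume "x \<in> range c" "y \<in> range c" "x \<noteq> y"
    then obtain s t where "x = c s" "y = c t" "s \<noteq> t" by blast
    then show "scrambled_pair (config_dist \<Gamma> \<beta>) (gen_shift X \<Gamma> \<eta>) x y" using scr by simp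
  qed
  moreover have "uncountable (range c)"
  proof
    assume "countable (range c)"
    then have "countable (UNIV :: nat set set)" using inj_c by (rule countable_image_inj_on)
    then have "range (from_nat_into (UNIV :: nat set set)) = UNIV"
      by (intro range_from_nat_into) simp
    then show False using Cantors_theorem[of "UNIV :: nat set"] by (metis Pow_UNIV)
  qed
  ultimately show ?thesis unfolding Li_Yorke_chaotic_def by blast
qed

section \<open>Comparison of the three classes\<close>

theorem mainTheorem3:
  fixes X :: "'a set" and \<Gamma> :: "'g set" and \<beta> :: "nat \<Rightarrow> 'g"
  assumes "finite X" and "2 \<le> card X"
    and "countable \<Gamma>" and "\<Gamma> \<noteq> {}"
    and "enumeration \<beta> \<Gamma>"
  shows "Devaney_class X \<Gamma> \<beta> \<subseteq> densely_class X \<Gamma> \<beta> \<and>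
         densely_class X \<Gamma> \<beta> \<subseteq> Li_Yorke_class X \<Gamma> \<beta> \<and>
         (infinite \<Gamma> \<longrightarrow>
            Devaney_class X \<Gamma> \<beta> \<subset> densely_class X \<Gamma> \<beta> \<and>
            densely_class X \<Gamma> \<beta> \<subset> Li_Yorke_class X \<Gamma> \<beta>)"
proof -
  note \<beta> = assms(5)
  let ?Z = "config_space X \<Gamma>" and ?d = "config_dist \<Gamma> \<beta>" and ?f = "gen_shift X \<Gamma>"
  obtain a b where ab: "a \<in> X" "b \<in> X" "a \<noteq> b"
    using card_le_Suc0_iff_eq[OF assms(1)] assms(2) by auto
  have "densely_chaotic ?Z ?d (?f \<eta>)" if "\<eta> \<in> \<Gamma> \<rightarrow> \<Gamma>" "Devaney_chaotic ?Z ?d (?f \<eta>)" for \<eta>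
    using that aperiodic_imp_densely_chaotic[OF \<beta> that(1) ab assms(4)]
      transitive_imp_aperiodic[OF \<beta> that(1) ab] by (simp add: Devaney_chaotic_def)
  then have sub1: "Devaney_class X \<Gamma> \<beta> \<subseteq> densely_class X \<Gamma> \<beta>"
    unfolding Devaney_class_def densely_class_def by blast
  have "Li_Yorke_chaotic ?Z ?d (?f \<eta>)" if "\<eta> \<in> \<Gamma> \<rightarrow> \<Gamma>" "densely_chaotic ?Z ?d (?f \<eta>)" for \<eta>
  proof -
    obtain \<alpha> where \<alpha>: "\<alpha> \<in> \<Gamma>" using assms(4) by blast
    have "aperiodic_on \<Gamma> \<eta>" by (rule densely_chaotic_imp_aperiodic[OF \<beta> that(1) ab that(2)])
    then show ?thesis
      using infinite_orbit_imp_Li_Yorke[OF \<beta> that(1) ab \<alpha>] aperiodic_imp_inj_orbit[OF _ that(1) \<alpha>]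
      by blast
  qed
  then have sub2: "densely_class X \<Gamma> \<beta> \<subseteq> Li_Yorke_class X \<Gamma> \<beta>"
    unfolding densely_class_def Li_Yorke_class_def by blast
  have "Devaney_class X \<Gamma> \<beta> \<noteq> densely_class X \<Gamma> \<beta> \<and> densely_class X \<Gamma> \<beta> \<noteq> Li_Yorke_class X \<Gamma> \<beta>"
    if inf: "infinite \<Gamma>"
  proof -
    have bij: "bij_betw \<beta> {1..} \<Gamma>"
      using \<beta> inf by (simp add: enumeration_def enum_indices_def)
    \<comment> \<open>The counterexamples are built on the positive integers, the index set of the
      enumeration, and transported to \<open>\<Gamma>\<close>.\<close>
    define tr where "tr h = \<beta> \<circ> h \<circ> inv_into {1..} \<beta>" for h :: "nat \<Rightarrow> nat"
    have img: "\<beta> ` {1..} = \<Gamma>" using bij by (simp add: bij_betw_def)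
    have \<beta>_in: "\<beta> k \<in> \<Gamma>" if "k \<ge> 1" for k using img that by auto
    have \<beta>_eq: "\<beta> k = \<beta> l \<longleftrightarrow> k = l" if "k \<ge> 1" "l \<ge> 1" for k l
      using bij that by (auto simp: bij_betw_def inj_on_def)
    have \<beta>_cases: "\<exists>k\<ge>1. \<gamma> = \<beta> k" if "\<gamma> \<in> \<Gamma>" for \<gamma> using img that by auto
    have tr: "tr h (\<beta> k) = \<beta> (h k)" if "k \<ge> 1" for h k
      using bij_betw_inv_into_left[OF bij] that by (simp add: tr_def)
    have tr_in: "tr h \<in> \<Gamma> \<rightarrow> \<Gamma>" if "\<And>k. k \<ge> 1 \<Longrightarrow> h k \<ge> 1" for h
      using that \<beta>_cases tr \<beta>_in by (metis Pi_I)
    have tr_pow: "(h ^^ n) k \<ge> 1 \<and> (tr h ^^ n) (\<beta> k) = \<beta> ((h ^^ n) k)"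
      if "\<And>k. k \<ge> 1 \<Longrightarrow> h k \<ge> 1" "k \<ge> 1" for h n k
      using that tr by (induction n) auto

    \<comment> \<open>Indices 1 and 2 are merged, and every index moves to a larger one.\<close>
    define h1 :: "nat \<Rightarrow> nat" where "h1 k = max k 2 + 1" for k
    have h1: "h1 k \<ge> 1" "h1 k > k" for k by (auto simp: h1_def)
    have in1: "tr h1 \<in> \<Gamma> \<rightarrow> \<Gamma>" by (rule tr_in) (rule h1)
    have grow: "(h1 ^^ n) k \<ge> k + n" for n k
    proof (induction n)
      case (Suc n)
      with h1(2)[of "(h1 ^^ n) k"] show ?case by simp
    qed simp
    have "aperiodic_on \<Gamma> (tr h1)"
      unfolding aperiodic_on_def
    proof (intro ballI allI impI)
      fix \<gamma> and n :: nat assume "\<gamma> \<in> \<Gamma>" "n \<ge> 1"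
      then obtain k where k: "k \<ge> 1" "\<gamma> = \<beta> k" using \<beta>_cases by blast
      show "(tr h1 ^^ n) \<gamma> \<noteq> \<gamma>"
        using tr_pow[of h1 k n, OF h1(1) k(1)] \<beta>_eq[of "(h1 ^^ n) k" k] grow[of k n]
          k \<open>n \<ge> 1\<close> by auto
    qed
    then have "densely_chaotic ?Z ?d (?f (tr h1))"
      by (rule aperiodic_imp_densely_chaotic[OF \<beta> in1 ab assms(4)])
    then have "(?Z, ?f (tr h1)) \<in> densely_class X \<Gamma> \<beta>"
      unfolding densely_class_def using in1 by blast
    moreover have "\<not> inj_on (tr h1) \<Gamma>"
    proof
      assume "inj_on (tr h1) \<Gamma>"
      moreover have "tr h1 (\<beta> 1) = tr h1 (\<beta> 2)" using tr[of 1 h1] tr[of 2 h1] by (simp add: h1_def numeral_eq_Suc)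
      ultimately have "\<beta> 1 = \<beta> 2" using \<beta>_in[of 1] \<beta>_in[of 2] by (simp add: inj_on_eq_iff)
      then show False using \<beta>_eq[of 1 2] by simp
    qed
    then have not_h1: "\<not> Devaney_chaotic ?Z ?d (?f (tr h1))"
      using transitive_imp_inj_on[OF \<beta> in1 ab] by (auto simp: Devaney_chaotic_def)
    have "(?Z, ?f (tr h1)) \<notin> Devaney_class X \<Gamma> \<beta>"
    proof
      assume "(?Z, ?f (tr h1)) \<in> Devaney_class X \<Gamma> \<beta>"
      then obtain \<eta> where "?f (tr h1) = ?f \<eta>" "Devaney_chaotic ?Z ?d (?f \<eta>)"
        unfolding Devaney_class_def mem_Collect_eq prod.inject by (elim exE conjE) simp
      with not_h1 show False by simp
    qed
    ultimately have ne1: "Devaney_class X \<Gamma> \<beta> \<noteq> densely_class X \<Gamma> \<beta>" by blast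

    \<comment> \<open>Index 1 is fixed, and the remaining ones form an infinite orbit.\<close>
    define h2 :: "nat \<Rightarrow> nat" where "h2 k = (if k = 1 then 1 else k + 1)" for k
    have h2: "h2 k \<ge> 1" for k by (auto simp: h2_def)
    have in2: "tr h2 \<in> \<Gamma> \<rightarrow> \<Gamma>" by (rule tr_in) (rule h2)
    have h2_pow: "(h2 ^^ n) 2 = n + 2" for n by (induction n) (auto simp: h2_def)
    have "inj (\<lambda>n. (tr h2 ^^ n) (\<beta> 2))"
    proof (rule injI)
      fix m n assume "(tr h2 ^^ m) (\<beta> 2) = (tr h2 ^^ n) (\<beta> 2)"
      then have "\<beta> (m + 2) = \<beta> (n + 2)"
        using tr_pow[of h2 2, OF h2] by (simp add: h2_pow)
      then show "m = n" using \<beta>_eq[of "m + 2" "n + 2"] by simp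
    qed
    then have "Li_Yorke_chaotic ?Z ?d (?f (tr h2))"
      using \<beta>_in[of 2] by (intro infinite_orbit_imp_Li_Yorke[OF \<beta> in2 ab]) auto
    then have "(?Z, ?f (tr h2)) \<in> Li_Yorke_class X \<Gamma> \<beta>"
      unfolding Li_Yorke_class_def using in2 by blast
    moreover have "\<not> aperiodic_on \<Gamma> (tr h2)"
    proof
      assume "aperiodic_on \<Gamma> (tr h2)"
      then have "(tr h2 ^^ 1) (\<beta> 1) \<noteq> \<beta> 1" using \<beta>_in[of 1] unfolding aperiodic_on_def by blast
      then show False using tr[of 1 h2] by (simp add: h2_def)
    qed
    then have not_h2: "\<not> densely_chaotic ?Z ?d (?f (tr h2))"
      using densely_chaotic_imp_aperiodic[OF \<beta> in2 ab] by blast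
    have "(?Z, ?f (tr h2)) \<notin> densely_class X \<Gamma> \<beta>"
    proof
      assume "(?Z, ?f (tr h2)) \<in> densely_class X \<Gamma> \<beta>"
      then obtain \<eta> where "?f (tr h2) = ?f \<eta>" "densely_chaotic ?Z ?d (?f \<eta>)"
        unfolding densely_class_def mem_Collect_eq prod.inject by (elim exE conjE) simp
      with not_h2 show False by simp
    qed
    ultimately have "densely_class X \<Gamma> \<beta> \<noteq> Li_Yorke_class X \<Gamma> \<beta>" by blast
    with ne1 show ?thesis by blast
  qed
  with sub1 sub2 show ?thesis by blast
qed

end
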